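(* Let $\mathcal{F}$ be a non-degenerate pencil of conics in $\mathbb{C}P^2$ with base points $A,B,C,D$, and let $\Gamma_1,\Gamma_2,\Gamma_3,\Gamma_4$ be four pairwise distinct conics in $\mathcal{F}$. For $i=1,2,3,4$ let $k_i=(A,B,C,D)_{\Gamma_i}\in\mathbb{C}\cup\{\infty\}$ be the number which uniquely determines $\Gamma_i$ among the conics of $\mathcal{F}$. Then $$(\Gamma_1,\Gamma_2,\Gamma_3,\Gamma_4)=(k_1,k_2,k_3,k_4).$$
   Context: We work in $\mathbb{C}P^2$. A conic is the zero set of a non-zero quadratic form on $\mathbb{C}^3$ (up to scalar), possibly degenerate; it is identified with a point of $\mathbb{P}(Q(\mathbb{C}^3))$, where $Q(\mathbb{C}^3)$ is the space of quadratic forms. A pencil of conics is a projective line in $\mathbb{P}(Q(\mathbb{C}^3))$. It is non-degenerate if it consists of all conics through four distinct points, no three collinear (its base points). The cross ratio of four points on a projective line, in terms of an affine coordinate, is $(A,B,C,D)=\frac{(A-C)(B-D)}{(B-C)(A-D)}$, with values in $\mathbb{C}\cup\{\infty\}$ (computed with the usual conventions when one of the points is at infinity). The cross ratio $(k_1,k_2,k_3,k_4)$ is taken on the projective line $\mathbb{C}\cup\{\infty\}$. The cross ratio of four concurrent lines is their cross ratio as points of a line in the dual projective plane (equivalently, the cross ratio of their intersection points with any line not through the common point). The cross ratio $(\Gamma_1,\Gamma_2,\Gamma_3,\Gamma_4)$ of four conics in a pencil is their cross ratio as points of the projective line in $\mathbb{P}(Q(\mathbb{C}^3))$ which is the pencil.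 For a conic $\Gamma$ through $A,B,C,D$ (no three of which are collinear), $(A,B,C,D)_{\Gamma}$ denotes the cross ratio of the lines $(PA,PB,PC,PD)$ for any point $P\in\Gamma$ different from $A,B,C,D$; it is independent of $P$. A conic through $A,B,C,D$ is uniquely determined by the value $k=(A,B,C,D)_\Gamma$. (The three degenerate conics of the pencil correspond to the values $0$, $1$, $\infty$.) *)

theory Defs
  imports "HOL-Analysis.Analysis" "HOL-Library.Function_Algebras"
begin

section \<open>The cross ratio on a field extended by one point at infinity\<close>

text \<open>The field extended by infinity is \<^typ>\<open>'a option\<close>, with \<^term>\<open>None\<close> as the point at infinity.\<close>

definition ratio :: "'a::field \<Rightarrow> 'a \<Rightarrow> 'a option" where
  "ratio a b = (if b = 0 then None else Some (a / b))"

text \<open>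
  The determinant of the homogeneous coordinates, a finite point \<open>a\<close> being written
  \<open>(a, 1)\<close> and infinity \<open>(1, 0)\<close>. In the cross ratio below it yields the usual
  conventions: two factors containing a point at infinity cancel, up to sign.
\<close>

fun difference :: "'a::field option \<Rightarrow> 'a option \<Rightarrow> 'a" where
  "difference (Some a) (Some b) = a - b"
| "difference None (Some b) = 1"
| "difference (Some a) None = - 1"
| "difference None None = 0"

text \<open>The value is only meaningful if no three of the four arguments coincide.\<close>

definition cross_ratio ::
  "'a::field option \<Rightarrow> 'a option \<Rightarrow> 'a option \<Rightarrow> 'a option \<Rightarrow> 'a option" where
  "cross_ratio a b c d =
     ratio (difference a c * difference b d) (difference b c * difference a d)"

section \<open>Projective spaces of vector spaces\<close>

text \<open>
  The vector space is given by its scalar multiplication \<open>s\<close>.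
  A point of the projective space of a subspace \<open>V\<close> is a one-dimensional subspace of \<open>V\<close>;
  a projective line is the set of all points contained in a two-dimensional subspace.
\<close>

definition projective_points ::
  "('a::field \<Rightarrow> 'b::ab_group_add \<Rightarrow> 'b) \<Rightarrow> 'b set \<Rightarrow> 'b set set" where
  "projective_points s V = {module.span s {v} | v. v \<in> V \<and> v \<noteq> 0}"

definition projective_lines ::
  "('a::field \<Rightarrow> 'b::ab_group_add \<Rightarrow> 'b) \<Rightarrow> 'b set \<Rightarrow> 'b set set set" where
  "projective_lines s V =
     {{p \<in> projective_points s V. p \<subseteq> module.span s {u, v}} | u v.
        u \<in> V \<and> v \<in> V \<and> u \<noteq> v \<and> \<not> module.dependent s {u, v}}"

text \<open>On the line spanned by \<open>u\<close> and \<open>v\<close>, the point spanned by \<open>a u + b v\<close> has the coordinate \<open>a / b\<close>.\<close>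

definition has_coordinate ::
  "('a::field \<Rightarrow> 'b::ab_group_add \<Rightarrow> 'b) \<Rightarrow> 'b \<Rightarrow> 'b \<Rightarrow> 'b set \<Rightarrow> 'a option \<Rightarrow> bool" where
  "has_coordinate s u v p k \<longleftrightarrow>
     (\<exists>a b. (a \<noteq> 0 \<or> b \<noteq> 0) \<and> p = module.span s {s a u + s b v} \<and> k = ratio a b)"

text \<open>
  The four points must lie on a common projective line, and no three of them may coincide;
  then the value does not depend on the choice of \<open>u\<close> and \<open>v\<close>.
\<close>

definition projective_cross_ratio ::
  "('a::field \<Rightarrow> 'b::ab_group_add \<Rightarrow> 'b) \<Rightarrow> 'b set \<Rightarrow> 'b set \<Rightarrow> 'b set \<Rightarrow> 'b set \<Rightarrow> 'a option" where
  "projective_cross_ratio s p1 p2 p3 p4 =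
     (THE r. \<exists>u v k1 k2 k3 k4. u \<noteq> v \<and> \<not> module.dependent s {u, v} \<and>
        has_coordinate s u v p1 k1 \<and> has_coordinate s u v p2 k2 \<and>
        has_coordinate s u v p3 k3 \<and> has_coordinate s u v p4 k4 \<and>
        r = cross_ratio k1 k2 k3 k4)"

section \<open>The complex projective plane and its dual\<close>

type_synonym point = "(complex ^ 3) set"
type_synonym line = "point set"

definition CP2 :: "point set" where
  "CP2 = projective_points (*s) UNIV"

definition collinear_points :: "point \<Rightarrow> point \<Rightarrow> point \<Rightarrow> bool" where
  "collinear_points P Q R \<longleftrightarrow> (\<exists>l \<in> projective_lines (*s) UNIV. P \<in> l \<and> Q \<in> l \<and> R \<in> l)"

definition line_through :: "point \<Rightarrow> point \<Rightarrow> line" where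
  "line_through P Q = {X \<in> CP2. X \<subseteq> vec.span (P \<union> Q)}"

definition scale_fun :: "complex \<Rightarrow> (complex ^ 3 \<Rightarrow> complex) \<Rightarrow> (complex ^ 3 \<Rightarrow> complex)" where
  "scale_fun c f = (\<lambda>x. c * f x)"

global_interpretation func: vector_space scale_fun
  by unfold_locales (auto simp: scale_fun_def fun_eq_iff algebra_simps)

text \<open>The linear forms vanishing on a line: a point of the dual projective plane.\<close>

definition dual_point :: "line \<Rightarrow> (complex ^ 3 \<Rightarrow> complex) set" where
  "dual_point l = {f. Vector_Spaces.linear (*s) (*) f \<and> (\<forall>P\<in>l. \<forall>x\<in>P. f x = 0)}"

definition line_cross_ratio :: "line \<Rightarrow> line \<Rightarrow> line \<Rightarrow> line \<Rightarrow> complex option" where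
  "line_cross_ratio l1 l2 l3 l4 =
     projective_cross_ratio scale_fun (dual_point l1) (dual_point l2) (dual_point l3) (dual_point l4)"

section \<open>Conics and pencils\<close>

definition quadratic_forms :: "(complex ^ 3 \<Rightarrow> complex) set" where
  "quadratic_forms = {q. \<exists>M :: complex ^ 3 ^ 3. \<forall>x. q x = (\<Sum>i\<in>UNIV. \<Sum>j\<in>UNIV. M $ i $ j * x $ i * x $ j)}"

text \<open>A conic is a point of the projective space of quadratic forms, hence a set of quadratic forms.\<close>

type_synonym conic = "(complex ^ 3 \<Rightarrow> complex) set"

definition conics :: "conic set" where
  "conics = projective_points scale_fun quadratic_forms"

definition conic_points :: "conic \<Rightarrow> point set" where
  "conic_points \<Gamma> = {P \<in> CP2. \<forall>q\<in>\<Gamma>. \<forall>x\<in>P. q x = 0}"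

definition pencils :: "conic set set" where
  "pencils = projective_lines scale_fun quadratic_forms"

definition nondegenerate_pencil :: "conic set \<Rightarrow> point \<Rightarrow> point \<Rightarrow> point \<Rightarrow> point \<Rightarrow> bool" where
  "nondegenerate_pencil F A B C D \<longleftrightarrow>
     F \<in> pencils \<and> {A, B, C, D} \<subseteq> CP2 \<and> distinct [A, B, C, D] \<and>
     \<not> collinear_points A B C \<and> \<not> collinear_points A B D \<and>
     \<not> collinear_points A C D \<and> \<not> collinear_points B C D \<and>
     F = {\<Gamma> \<in> conics. {A, B, C, D} \<subseteq> conic_points \<Gamma>}"

text \<open>
  The cross ratio of four points with respect to a conic through them. The auxiliary point
  \<open>P\<close> may be any further point of the conic: if no three of the four points
  are collinear, the value does not depend on it.
\<close>

definition conic_cross_ratio :: "conic \<Rightarrow> point \<Rightarrow> point \<Rightarrow> point \<Rightarrow> point \<Rightarrow> complex option" where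
  "conic_cross_ratio \<Gamma> A B C D =
     (THE k. \<exists>P. P \<in> conic_points \<Gamma> \<and> P \<notin> {A, B, C, D} \<and>
        k = line_cross_ratio (line_through P A) (line_through P B)
              (line_through P C) (line_through P D))"

definition conics_cross_ratio :: "conic \<Rightarrow> conic \<Rightarrow> conic \<Rightarrow> conic \<Rightarrow> complex option" where
  "conics_cross_ratio = projective_cross_ratio scale_fun"

end

theory Submission
  imports Defs
begin

text \<open>
  Write \<open>[x, y, z]\<close> for the triple product, and let \<open>a, b, c, d\<close> be vectors representing the base
  points. Seen from a point \<open>p\<close>, the lines to the base points have the cross ratio
  \<open>[p, a, c] [p, b, d] / ([p, b, c] [p, a, d])\<close>, which is \<open>q\<^sub>0 p / q\<^sub>1 p\<close> for the two degenerate
  quadratic forms \<open>q\<^sub>0 x = [x, a, c] [x, b, d]\<close> and \<open>q\<^sub>1 x = [x, b, c] [x, a, d]\<close> spanning the pencil.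
  On the conic \<open>l q\<^sub>0 + m q\<^sub>1 = 0\<close> it is the constant \<open>- m / l\<close>, and this is precisely the affine
  coordinate of that conic with respect to the basis \<open>- q\<^sub>1, q\<^sub>0\<close> of the pencil.
\<close>

section \<open>Cross ratios in homogeneous coordinates\<close>

lemma ratio_eqI: "t \<noteq> 0 \<Longrightarrow> a' = t * a \<Longrightarrow> b' = t * b \<Longrightarrow> ratio a' b' = ratio a b"
  by (simp add: ratio_def)

text \<open>The point \<open>ratio a b\<close> has homogeneous coordinates (a, b), which
  \<open>difference\<close> uses after division by b, or by a when b = 0. Each normalisation divides
  the determinant by its own factor, infinity included.\<close>

lemma difference_ratio:
  assumes "a \<noteq> 0 \<or> b \<noteq> 0" "c \<noteq> 0 \<or> d \<noteq> 0"
  shows "difference (ratio a b) (ratio c d) =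
    (a * d - b * c) * inverse (if b = 0 then a else b) * inverse (if d = 0 then c else d)"
  using assms by (auto simp: ratio_def field_simps)

text \<open>Every point occurs once above and once below the fraction bar, so the four normalising
  factors enter both products equally and cancel. Any homogeneous coordinates may therefore be
  used.\<close>

lemma cross_ratio_ratio:
  assumes "a1 \<noteq> 0 \<or> b1 \<noteq> 0" "a2 \<noteq> 0 \<or> b2 \<noteq> 0" "a3 \<noteq> 0 \<or> b3 \<noteq> 0" "a4 \<noteq> 0 \<or> b4 \<noteq> 0"
  shows "cross_ratio (ratio a1 b1) (ratio a2 b2) (ratio a3 b3) (ratio a4 b4) =
    ratio ((a1 * b3 - b1 * a3) * (a2 * b4 - b2 * a4)) ((a2 * b3 - b2 * a3) * (a1 * b4 - b1 * a4))"
proof -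
  define n where "n a b = inverse (if b = 0 then a else b)" for a b :: 'a
  have "n a1 b1 * n a2 b2 * n a3 b3 * n a4 b4 \<noteq> 0"
    using assms by (auto simp: n_def)
  then show ?thesis
    unfolding cross_ratio_def
    by (rule ratio_eqI) (simp_all only: difference_ratio assms n_def mult_ac)
qed

text \<open>The coordinate pairs are multiplied by one 2 by 2 matrix and rescaled separately. Each
  determinant then gains the determinant of the matrix and two of the scalars, so numerator and
  denominator both gain \<open>t1 * t2 * t3 * t4 * \<Delta> * \<Delta>\<close>.\<close>

lemma cross_ratio_basis_change:
  assumes "a1 \<noteq> 0 \<or> b1 \<noteq> 0" "a2 \<noteq> 0 \<or> b2 \<noteq> 0" "a3 \<noteq> 0 \<or> b3 \<noteq> 0" "a4 \<noteq> 0 \<or> b4 \<noteq> 0"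
    and "a1' \<noteq> 0 \<or> b1' \<noteq> 0" "a2' \<noteq> 0 \<or> b2' \<noteq> 0" "a3' \<noteq> 0 \<or> b3' \<noteq> 0" "a4' \<noteq> 0 \<or> b4' \<noteq> 0"
    and "t1 \<noteq> 0" "t2 \<noteq> 0" "t3 \<noteq> 0" "t4 \<noteq> 0" "\<alpha> * \<delta> - \<beta> * \<gamma> \<noteq> 0"
    and eqs: "a1' = t1 * (a1 * \<alpha> + b1 * \<gamma>)" "b1' = t1 * (a1 * \<beta> + b1 * \<delta>)"
      "a2' = t2 * (a2 * \<alpha> + b2 * \<gamma>)" "b2' = t2 * (a2 * \<beta> + b2 * \<delta>)"
      "a3' = t3 * (a3 * \<alpha> + b3 * \<gamma>)" "b3' = t3 * (a3 * \<beta> + b3 * \<delta>)"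
      "a4' = t4 * (a4 * \<alpha> + b4 * \<gamma>)" "b4' = t4 * (a4 * \<beta> + b4 * \<delta>)"
  shows "cross_ratio (ratio a1' b1') (ratio a2' b2') (ratio a3' b3') (ratio a4' b4') =
    cross_ratio (ratio a1 b1) (ratio a2 b2) (ratio a3 b3) (ratio a4 b4)"
proof -
  define \<Delta> where "\<Delta> = \<alpha> * \<delta> - \<beta> * \<gamma>"
  have *: "(t * (a * \<alpha> + b * \<gamma>)) * (t' * (c * \<beta> + d * \<delta>)) -
      (t * (a * \<beta> + b * \<delta>)) * (t' * (c * \<alpha> + d * \<gamma>)) = t * t' * \<Delta> * (a * d - b * c)"
    for t t' a b c d unfolding \<Delta>_def by (simp add: algebra_simps)
  have "t1 * t2 * t3 * t4 * \<Delta> * \<Delta> \<noteq> 0"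
    using assms by (simp add: \<Delta>_def)
  then show ?thesis
    unfolding cross_ratio_ratio[OF assms(1-4)] cross_ratio_ratio[OF assms(5-8)]
    by (rule ratio_eqI) (simp_all only: eqs *, simp_all only: mult_ac)
qed

section \<open>Independent pairs of vectors, and independence of the projective cross ratio from the
  basis\<close>

context vector_space
begin

text \<open>For u = v the set collapses to a singleton, which may well be independent; this is why
  the inequality accompanies independence throughout.\<close>

lemma independent_pair_iff:
  "u \<noteq> v \<and> independent {u, v} \<longleftrightarrow> (\<forall>a b. scale a u + scale b v = 0 \<longrightarrow> a = 0 \<and> b = 0)"
proof (intro iffI allI impI)
  fix a b assume uv: "u \<noteq> v \<and> independent {u, v}" and 0: "scale a u + scale b v = 0"
  define f where "f x = (if x = u then a else b)" for x
  have "v \<noteq> u" using uv by blast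
  then have f: "f u = a" "f v = b" by (simp_all add: f_def)
  have "(\<Sum>x\<in>{u, v}. scale (f x) x) = scale (f u) u + scale (f v) v"
    using uv by simp
  also have "\<dots> = 0" unfolding f by (rule 0)
  finally have "(\<Sum>x\<in>{u, v}. scale (f x) x) = 0" .
  with uv have "f u = 0" "f v = 0"
    using independentD[of "{u, v}" "{u, v}" f] by blast+
  then show "a = 0 \<and> b = 0"
    unfolding f ..
next
  assume *: "\<forall>a b. scale a u + scale b v = 0 \<longrightarrow> a = 0 \<and> b = 0"
  have uv: "u \<noteq> v"
  proof
    assume "u = v"
    then have "scale 1 u + scale (- 1) v = 0" by simp
    with * have "(1::'a) = 0" by blast
    then show False by simp
  qed
  have "v \<noteq> 0"
  proof
    assume "v = 0"
    then have "scale 0 u + scale 1 v = 0" by simp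
    with * have "(1::'a) = 0" by blast
    then show False by simp
  qed
  moreover have "u \<notin> span {v}"
  proof
    assume "u \<in> span {v}"
    then obtain k where "u = scale k v" by (auto simp: span_singleton)
    then have "scale 1 u + scale (- k) v = 0" by simp
    with * have "(1::'a) = 0" by blast
    then show False by simp
  qed
  ultimately show "u \<noteq> v \<and> independent {u, v}"
    using uv by (simp add: independent_insert)
qed

lemma mem_span_pair_iff: "x \<in> span {u, v} \<longleftrightarrow> (\<exists>a b. x = scale a u + scale b v)"
proof -
  have "x = y + z \<longleftrightarrow> x - y = z" for y z by (auto simp: algebra_simps)
  then show ?thesis by (auto simp: span_insert[of u] span_singleton)
qed

lemma span_singleton_scale: "t \<noteq> 0 \<Longrightarrow> span {scale t x} = span {x}"
  by (rule span_image_scale[of "{x}" "\<lambda>_. t", simplified])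

lemma span_singleton_eqD:
  assumes "span {x} = span {y}" "y \<noteq> 0"
  obtains t where "t \<noteq> 0" "y = scale t x"
proof -
  have "y \<in> span {x}" using assms(1) span_base[of y "{y}"] by simp
  then obtain t where "y = scale t x" by (auto simp: span_singleton)
  with assms(2) show ?thesis by (intro that[of t]) auto
qed

lemma has_coordinate_distinctD:
  assumes "span {scale a u + scale b v} \<noteq> span {scale c u + scale d v}"
    and "a \<noteq> 0 \<or> b \<noteq> 0" "c \<noteq> 0 \<or> d \<noteq> 0"
  shows "a * d - b * c \<noteq> 0"
proof
  assume "a * d - b * c = 0"
  then have eq: "a * d = b * c" by simp
  \<comment> \<open>A vanishing determinant makes the coordinate pairs proportional; the factor is
    read off from whichever of a and b is known to be nonzero.\<close>
  define t where "t = (if a = 0 then d / b else c / a)"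
  have t: "t \<noteq> 0" "c = t * a" "d = t * b"
    using assms(2,3) eq by (auto simp: t_def field_simps)
  then have "scale c u + scale d v = scale t (scale a u + scale b v)"
    by (simp add: scale_right_distrib)
  with assms(1) t(1) show False by (simp add: span_singleton_scale)
qed

text \<open>Cramer's rule: the 2 by 2 system is invertible, so u and v are combinations of the two
  given vectors, with the entries of the inverse matrix as coefficients.\<close>

lemma mem_subspace_pair:
  assumes "subspace S" "scale a u + scale b v \<in> S" "scale c u + scale d v \<in> S" "a * d - b * c \<noteq> 0"
  shows "u \<in> S \<and> v \<in> S"
proof -
  define w where "w a b = scale a u + scale b v" for a b
  define t where "t = inverse (a * d - b * c)"
  have t: "t * (a * d - b * c) = 1" using assms(4) by (simp add: t_def)
  have "scale (t * d) (w a b) - scale (t * b) (w c d) = scale (t * (a * d - b * c)) u"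
    "scale (t * a) (w c d) - scale (t * c) (w a b) = scale (t * (a * d - b * c)) v"
    by (simp_all add: w_def algebra_simps)
  then have "u = scale (t * d) (w a b) - scale (t * b) (w c d)"
    "v = scale (t * a) (w c d) - scale (t * c) (w a b)"
    by (simp_all add: t)
  moreover have "w a b \<in> S" "w c d \<in> S"
    using assms(2,3) by (simp_all add: w_def)
  ultimately show ?thesis
    using assms(1) by (metis subspace_diff subspace_scale)
qed

text \<open>This resolves the definite description. Assumption \<open>ne\<close> says that numerator
  and denominator do not both vanish; it yields two distinct points, so every basis giving
  coordinates to all four points spans the same plane, and the change of basis is
  invertible.\<close>

lemma projective_cross_ratio_eqI:
  assumes uv: "u \<noteq> v" "independent {u, v}"
    and k: "has_coordinate scale u v p1 k1" "has_coordinate scale u v p2 k2"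
      "has_coordinate scale u v p3 k3" "has_coordinate scale u v p4 k4"
    and ne: "p1 \<noteq> p3 \<and> p2 \<noteq> p4 \<or> p2 \<noteq> p3 \<and> p1 \<noteq> p4"
  shows "projective_cross_ratio scale p1 p2 p3 p4 = cross_ratio k1 k2 k3 k4"
proof -
  define w where "w a b = scale a u + scale b v" for a b
  obtain a1 b1 where 1: "a1 \<noteq> 0 \<or> b1 \<noteq> 0" "p1 = span {w a1 b1}" "k1 = ratio a1 b1"
    using k(1) by (auto simp: has_coordinate_def w_def)
  obtain a2 b2 where 2: "a2 \<noteq> 0 \<or> b2 \<noteq> 0" "p2 = span {w a2 b2}" "k2 = ratio a2 b2"
    using k(2) by (auto simp: has_coordinate_def w_def)
  obtain a3 b3 where 3: "a3 \<noteq> 0 \<or> b3 \<noteq> 0" "p3 = span {w a3 b3}" "k3 = ratio a3 b3"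
    using k(3) by (auto simp: has_coordinate_def w_def)
  obtain a4 b4 where 4: "a4 \<noteq> 0 \<or> b4 \<noteq> 0" "p4 = span {w a4 b4}" "k4 = ratio a4 b4"
    using k(4) by (auto simp: has_coordinate_def w_def)
  have uvD: "a = 0 \<and> b = 0" if "scale a u + scale b v = 0" for a b
    using uv independent_pair_iff that by blast
  have unique: "cross_ratio k1' k2' k3' k4' = cross_ratio k1 k2 k3 k4"
    if uv': "u' \<noteq> v'" "independent {u', v'}"
      and k': "has_coordinate scale u' v' p1 k1'" "has_coordinate scale u' v' p2 k2'"
        "has_coordinate scale u' v' p3 k3'" "has_coordinate scale u' v' p4 k4'"
    for u' v' k1' k2' k3' k4'
  proof -
    define w' where "w' a b = scale a u' + scale b v'" for a b
    obtain a1' b1' where r1: "a1' \<noteq> 0 \<or> b1' \<noteq> 0" "p1 = span {w' a1' b1'}" "k1' = ratio a1' b1'"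
      using k'(1) by (auto simp: has_coordinate_def w'_def)
    obtain a2' b2' where r2: "a2' \<noteq> 0 \<or> b2' \<noteq> 0" "p2 = span {w' a2' b2'}" "k2' = ratio a2' b2'"
      using k'(2) by (auto simp: has_coordinate_def w'_def)
    obtain a3' b3' where r3: "a3' \<noteq> 0 \<or> b3' \<noteq> 0" "p3 = span {w' a3' b3'}" "k3' = ratio a3' b3'"
      using k'(3) by (auto simp: has_coordinate_def w'_def)
    obtain a4' b4' where r4: "a4' \<noteq> 0 \<or> b4' \<noteq> 0" "p4 = span {w' a4' b4'}" "k4' = ratio a4' b4'"
      using k'(4) by (auto simp: has_coordinate_def w'_def)
    have uvD': "a = 0 \<and> b = 0" if "scale a u' + scale b v' = 0" for a b
      using uv' independent_pair_iff that by blast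
    have w'_ne: "w' a b \<noteq> 0" if "a \<noteq> 0 \<or> b \<noteq> 0" for a b
      using uvD' that by (auto simp: w'_def)
    have in_span: "w a b \<in> span {u', v'}" if "span {w a b} = span {w' a' b'}" for a b a' b'
    proof -
      have "w a b \<in> span {w' a' b'}"
        using that span_base[of "w a b" "{w a b}"] by simp
      moreover have "w' a' b' \<in> span {u', v'}"
        by (auto simp: w'_def mem_span_pair_iff)
      ultimately show ?thesis
        by (metis empty_subsetI insert_subset span_minimal subsetD subspace_span)
    qed
    \<comment> \<open>Either alternative provides two distinct points, whose representatives lie in
      both planes and generate the first.\<close>
    have "u \<in> span {u', v'} \<and> v \<in> span {u', v'}"
      using ne
    proof
      assume "p1 \<noteq> p3 \<and> p2 \<noteq> p4"
      then have ne: "a1 * b3 - b1 * a3 \<noteq> 0"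
        using 1 3 by (intro has_coordinate_distinctD[of _ u _ v]) (auto simp: w_def)
      have mem: "w a1 b1 \<in> span {u', v'}" "w a3 b3 \<in> span {u', v'}"
        using in_span[of a1 b1 a1' b1'] in_span[of a3 b3 a3' b3'] 1(2) 3(2) r1(2) r3(2)
        by simp_all
      show ?thesis by (rule mem_subspace_pair[OF subspace_span mem[unfolded w_def] ne])
    next
      assume "p2 \<noteq> p3 \<and> p1 \<noteq> p4"
      then have ne: "a2 * b3 - b2 * a3 \<noteq> 0"
        using 2 3 by (intro has_coordinate_distinctD[of _ u _ v]) (auto simp: w_def)
      have mem: "w a2 b2 \<in> span {u', v'}" "w a3 b3 \<in> span {u', v'}"
        using in_span[of a2 b2 a2' b2'] in_span[of a3 b3 a3' b3'] 2(2) 3(2) r2(2) r3(2)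
        by simp_all
      show ?thesis by (rule mem_subspace_pair[OF subspace_span mem[unfolded w_def] ne])
    qed
    then obtain \<alpha> \<beta> \<gamma> \<delta> where u: "u = scale \<alpha> u' + scale \<beta> v'" and v: "v = scale \<gamma> u' + scale \<delta> v'"
      by (auto simp: mem_span_pair_iff)
    \<comment> \<open>If the determinant were zero, the rows of the adjugate would give linear
      relations between u and v. They force \<open>\<alpha>\<close> and \<open>\<beta>\<close> to
      vanish, hence u = 0.\<close>
    have det: "\<alpha> * \<delta> - \<beta> * \<gamma> \<noteq> 0"
    proof
      assume 0: "\<alpha> * \<delta> - \<beta> * \<gamma> = 0"
      have "scale \<delta> u + scale (- \<beta>) v = scale (\<alpha> * \<delta> - \<beta> * \<gamma>) u'"
        by (simp add: u v algebra_simps)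
      then have "scale \<delta> u + scale (- \<beta>) v = 0" using 0 by simp
      from uvD[OF this] have "\<beta> = 0" by simp
      have "scale (- \<gamma>) u + scale \<alpha> v = scale (\<alpha> * \<delta> - \<beta> * \<gamma>) v'"
        by (simp add: u v algebra_simps)
      then have "scale (- \<gamma>) u + scale \<alpha> v = 0" using 0 by simp
      from uvD[OF this] have "\<alpha> = 0" by simp
      with \<open>\<beta> = 0\<close> u have "scale 1 u + scale 0 v = 0" by simp
      with uvD have "(1::'a) = 0" by blast
      then show False by simp
    qed
    have coord: "\<exists>t. t \<noteq> 0 \<and> a' = t * (a * \<alpha> + b * \<gamma>) \<and> b' = t * (a * \<beta> + b * \<delta>)"
      if eq: "span {w a b} = span {w' a' b'}" and nz: "a' \<noteq> 0 \<or> b' \<noteq> 0" for a b a' b'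
    proof -
      obtain t where t: "t \<noteq> 0" "w' a' b' = scale t (w a b)"
        using span_singleton_eqD[OF eq w'_ne[OF nz]] by blast
      have "scale (a' - t * (a * \<alpha> + b * \<gamma>)) u' + scale (b' - t * (a * \<beta> + b * \<delta>)) v' =
          w' a' b' - scale t (w a b)"
        by (simp add: w_def w'_def u v algebra_simps)
      with t(2) have "scale (a' - t * (a * \<alpha> + b * \<gamma>)) u' + scale (b' - t * (a * \<beta> + b * \<delta>)) v' = 0"
        by simp
      from uvD'[OF this] t(1) show ?thesis by (intro exI[of _ t]) simp
    qed
    obtain t1 where t1: "t1 \<noteq> 0" "a1' = t1 * (a1 * \<alpha> + b1 * \<gamma>)" "b1' = t1 * (a1 * \<beta> + b1 * \<delta>)"
      using coord 1 r1 by metis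
    obtain t2 where t2: "t2 \<noteq> 0" "a2' = t2 * (a2 * \<alpha> + b2 * \<gamma>)" "b2' = t2 * (a2 * \<beta> + b2 * \<delta>)"
      using coord 2 r2 by metis
    obtain t3 where t3: "t3 \<noteq> 0" "a3' = t3 * (a3 * \<alpha> + b3 * \<gamma>)" "b3' = t3 * (a3 * \<beta> + b3 * \<delta>)"
      using coord 3 r3 by metis
    obtain t4 where t4: "t4 \<noteq> 0" "a4' = t4 * (a4 * \<alpha> + b4 * \<gamma>)" "b4' = t4 * (a4 * \<beta> + b4 * \<delta>)"
      using coord 4 r4 by metis
    show ?thesis
      unfolding 1(3) 2(3) 3(3) 4(3) r1(3) r2(3) r3(3) r4(3)
      by (rule cross_ratio_basis_change[OF 1(1) 2(1) 3(1) 4(1) r1(1) r2(1) r3(1) r4(1)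
            t1(1) t2(1) t3(1) t4(1) det t1(2,3) t2(2,3) t3(2,3) t4(2,3)])
  qed
  show ?thesis
    unfolding projective_cross_ratio_def
  proof (rule the_equality)
    show "\<exists>u v k1' k2' k3' k4'. u \<noteq> v \<and> independent {u, v} \<and>
        has_coordinate scale u v p1 k1' \<and> has_coordinate scale u v p2 k2' \<and>
        has_coordinate scale u v p3 k3' \<and> has_coordinate scale u v p4 k4' \<and>
        cross_ratio k1 k2 k3 k4 = cross_ratio k1' k2' k3' k4'"
      using uv k by blast
  qed (use unique in blast)
qed

end

section \<open>Triple products\<close>

definition triple :: "'a::field ^ 3 \<Rightarrow> 'a ^ 3 \<Rightarrow> 'a ^ 3 \<Rightarrow> 'a" where
  "triple x y z =
     x$1 * (y$2 * z$3 - y$3 * z$2) - x$2 * (y$1 * z$3 - y$3 * z$1) + x$3 * (y$1 * z$2 - y$2 * z$1)"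

lemma triple_same [simp]: "triple x x y = 0" "triple x y x = 0" "triple y x x = 0"
  by (simp_all add: triple_def algebra_simps)

lemma triple_zero [simp]: "triple 0 x y = 0" "triple x 0 y = 0" "triple x y 0 = 0"
  by (simp_all add: triple_def)

lemma triple_add:
  "triple (x + x') y z = triple x y z + triple x' y z"
  "triple x (y + y') z = triple x y z + triple x y' z"
  "triple x y (z + z') = triple x y z + triple x y z'"
  by (simp_all add: triple_def algebra_simps)

lemma triple_scale:
  "triple (t *s x) y z = t * triple x y z"
  "triple x (t *s y) z = t * triple x y z"
  "triple x y (t *s z) = t * triple x y z"
  by (simp_all add: triple_def algebra_simps)

lemma triple_swap: "triple y x z = - triple x y z" "triple x z y = - triple x y z"
  by (simp_all add: triple_def algebra_simps)

lemma triple_cramer: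
  "triple a b c *s x = triple x b c *s a + triple a x c *s b + triple a b x *s c"
  by (simp add: vec_eq_iff forall_3 triple_def algebra_simps)

text \<open>Modulo p the space is a plane, in which x has the coordinates
  \<open>triple p x f\<close> and \<open>triple p e x\<close> with respect to e and f, up to the
  factor \<open>triple p e f\<close>. The right-hand side is the determinant of such coordinates of
  x and y.\<close>

lemma triple_plucker:
  "triple p e f * triple p x y = triple p x f * triple p e y - triple p e x * triple p y f"
  by (simp add: triple_def algebra_simps)

lemma proportional_if_triple_eq_0:
  assumes "\<And>z. triple x y z = 0" "x \<noteq> 0"
  obtains t where "y = t *s x"
proof -
  \<comment> \<open>Inserting the unit vectors for z extracts the three minors, that is, the cross
    product of x and y.\<close>
  have m: "x$2 * y$3 = x$3 * y$2" "x$1 * y$3 = x$3 * y$1" "x$1 * y$2 = x$2 * y$1"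
    using assms(1)[of "axis 1 1"] assms(1)[of "axis 2 1"] assms(1)[of "axis 3 1"]
    by (auto simp: triple_def axis_def algebra_simps)
  obtain i where i: "x $ i \<noteq> 0" using assms(2) by (auto simp: vec_eq_iff)
  have "\<forall>i j. x $ i * y $ j = x $ j * y $ i"
    using m by (auto simp: forall_3)
  then have "y = (y $ i / x $ i) *s x"
    using i by (simp add: vec_eq_iff field_simps)
  with that show ?thesis .
qed

text \<open>Complete a, b to a basis by some z. In Cramer's expansion of c the coefficient of z is
  the triple product of a, b, c; if it vanishes, c lies in the plane of a and b, and the three
  points are collinear.\<close>

lemma triple_ne_0:
  assumes "a \<noteq> 0" "b \<noteq> 0" "c \<noteq> 0" "vec.span {a} \<noteq> vec.span {b}"
    and "\<not> collinear_points (vec.span {a}) (vec.span {b}) (vec.span {c})"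
  shows "triple a b c \<noteq> 0"
proof
  assume 0: "triple a b c = 0"
  have "\<exists>z. triple a b z \<noteq> 0"
  proof (rule ccontr)
    assume "\<nexists>z. triple a b z \<noteq> 0"
    then obtain t where "b = t *s a"
      using proportional_if_triple_eq_0[of a b] assms(1) by blast
    with assms(2,4) show False by (auto simp: vec.span_singleton_scale)
  qed
  then obtain z where z: "triple a b z \<noteq> 0" ..
  have "s = 0 \<and> t = 0" if "s *s a + t *s b = 0" for s t
  proof -
    have "triple (s *s a + t *s b) b z = s * triple a b z"
      "triple a (s *s a + t *s b) z = t * triple a b z"
      by (simp_all add: triple_add triple_scale)
    with that z show ?thesis by auto
  qed
  then have ab: "a \<noteq> b" "vec.independent {a, b}"
    using vec.independent_pair_iff by blast+
  have "c = inverse (triple a b z) *s (triple a b z *s c)"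
    using z by simp
  also have "\<dots> = (inverse (triple a b z) * triple c b z) *s a + (inverse (triple a b z) * triple a c z) *s b"
    by (subst triple_cramer) (simp add: 0 vec.scale_right_distrib)
  finally have c: "c \<in> vec.span {a, b}"
    by (auto simp: vec.mem_span_pair_iff)
  have "vec.span {x} \<subseteq> vec.span {a, b}" if "x \<in> vec.span {a, b}" for x
    using that by (simp add: vec.span_minimal)
  then have sub: "vec.span {a} \<subseteq> vec.span {a, b}" "vec.span {b} \<subseteq> vec.span {a, b}"
    "vec.span {c} \<subseteq> vec.span {a, b}"
    using c vec.span_base[of a "{a, b}"] vec.span_base[of b "{a, b}"] by auto
  have "collinear_points (vec.span {a}) (vec.span {b}) (vec.span {c})"
    unfolding collinear_points_def projective_lines_def
  proof (intro bexI[where x="{p \<in> projective_points (*s) UNIV. p \<subseteq> vec.span {a, b}}"] conjI)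
    show "{p \<in> projective_points (*s) UNIV. p \<subseteq> vec.span {a, b}} \<in>
        {{p \<in> projective_points (*s) UNIV. p \<subseteq> vec.span {u, v}} | u v.
          u \<in> UNIV \<and> v \<in> UNIV \<and> u \<noteq> v \<and> vec.independent {u, v}}"
      using ab by blast
  qed (use sub assms in \<open>auto simp: projective_points_def\<close>)
  with assms(5) show False by simp
qed

section \<open>The cross ratio of four lines through a point\<close>

text \<open>The vector z completes p, a to a basis, so a linear form vanishing at p and a is
  determined by its value at z. Hence it is a multiple of \<open>triple p a\<close>.\<close>

lemma dual_point_line_through:
  assumes "triple p a z \<noteq> 0"
  shows "dual_point (line_through (vec.span {p}) (vec.span {a})) = func.span {triple p a}"
proof (intro set_eqI iffI)
  fix f assume f: "f \<in> dual_point (line_through (vec.span {p}) (vec.span {a}))"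
  have "p \<noteq> 0" "a \<noteq> 0" using assms by auto
  then have "vec.span {p} \<in> CP2" "vec.span {a} \<in> CP2"
    unfolding CP2_def projective_points_def by blast+
  moreover have "vec.span {p} \<union> vec.span {a} \<subseteq> vec.span (vec.span {p} \<union> vec.span {a})"
    by (rule vec.span_superset)
  ultimately have "vec.span {p} \<in> line_through (vec.span {p}) (vec.span {a})"
    "vec.span {a} \<in> line_through (vec.span {p}) (vec.span {a})"
    unfolding line_through_def by blast+
  moreover have "p \<in> vec.span {p}" "a \<in> vec.span {a}"
    by (simp_all add: vec.span_base)
  ultimately have 0: "f p = 0" "f a = 0"
    using f unfolding dual_point_def by blast+
  have "Vector_Spaces.linear (*s) (*) f"
    using f unfolding dual_point_def by blast
  then have f_add: "f (x + y) = f x + f y" and f_scale: "f (t *s x) = t * f x" for x y t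
    unfolding Vector_Spaces.linear_iff by blast+
  \<comment> \<open>Apply f to Cramer's expansion of x in p, a, z; only the term with z
    survives.\<close>
  have "f x = f z / triple p a z * triple p a x" for x
  proof -
    have "triple p a z * f x = triple p a x * f z"
      using arg_cong[OF triple_cramer[of p a z x], of f] by (simp add: f_add f_scale 0)
    then show ?thesis using assms by (simp add: field_simps)
  qed
  then have "f = scale_fun (f z / triple p a z) (triple p a)"
    unfolding scale_fun_def by (rule ext)
  then show "f \<in> func.span {triple p a}"
    unfolding func.span_singleton by (rule range_eqI)
next
  fix f assume "f \<in> func.span {triple p a}"
  then obtain k where f: "f = (\<lambda>x. k * triple p a x)"
    by (auto simp: func.span_singleton scale_fun_def)
  have "Vector_Spaces.linear (*s) (*) f"
    unfolding Vector_Spaces.linear_iff f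
    by (auto simp: vec.vector_space_axioms triple_add triple_scale algebra_simps
        intro: vector_space_over_itself.vector_space_axioms)
  moreover have "f x = 0" if "X \<in> line_through (vec.span {p}) (vec.span {a})" "x \<in> X" for X x
  proof -
    have "x \<in> vec.span (vec.span {p} \<union> vec.span {a})"
      using that by (auto simp: line_through_def)
    then obtain y z where yz: "y \<in> vec.span {p}" "z \<in> vec.span {a}" "x = y + z"
      unfolding vec.span_Un vec.span_span by blast
    then obtain s t where "y = s *s p" "z = t *s a"
      unfolding vec.span_singleton by blast
    with yz(3) have "x = s *s p + t *s a" by simp
    then show ?thesis by (simp add: f triple_add triple_scale)
  qed
  ultimately show "f \<in> dual_point (line_through (vec.span {p}) (vec.span {a}))"
    by (simp add: dual_point_def)
qed

text \<open>The lines through p form a projective line of the dual plane with basis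
  \<open>triple p e\<close>, \<open>triple p f\<close>. The Pluecker relation is used twice: it
  gives the coordinates of each line, and it turns the determinants of these coordinates into triple
  products.\<close>

lemma line_cross_ratio_line_through:
  assumes "triple p a c \<noteq> 0 \<and> triple p b d \<noteq> 0 \<or> triple p b c \<noteq> 0 \<and> triple p a d \<noteq> 0"
  shows "line_cross_ratio (line_through (vec.span {p}) (vec.span {a}))
      (line_through (vec.span {p}) (vec.span {b})) (line_through (vec.span {p}) (vec.span {c}))
      (line_through (vec.span {p}) (vec.span {d})) =
    ratio (triple p a c * triple p b d) (triple p b c * triple p a d)"
proof -
  \<comment> \<open>Two of the four given vectors serve as e and f, taken from a nonzero factor in
    the assumption.\<close>
  obtain e f where T: "triple p e f \<noteq> 0" using assms by blast
  have "s = 0 \<and> t = 0" if "scale_fun s (triple p e) + scale_fun t (triple p f) = 0" for s t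
  proof -
    have "s * triple p e x + t * triple p f x = 0" for x
      using fun_cong[OF that, of x] by (simp add: scale_fun_def)
    from this[of e] this[of f] show ?thesis
      using T by (auto simp: triple_swap(2)[of p e f])
  qed
  then have "triple p e \<noteq> triple p f \<and> func.independent {triple p e, triple p f}"
    unfolding func.independent_pair_iff by blast
  then have ind: "triple p e \<noteq> triple p f" "func.independent {triple p e, triple p f}"
    by simp_all
  have exp: "scale_fun (triple p x f) (triple p e) + scale_fun (triple p e x) (triple p f) =
      scale_fun (triple p e f) (triple p x)" for x
  proof
    fix y
    show "(scale_fun (triple p x f) (triple p e) + scale_fun (triple p e x) (triple p f)) y =
        scale_fun (triple p e f) (triple p x) y"
      using triple_plucker[of p e f x y] by (simp add: scale_fun_def triple_swap(2)[of p f y])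
  qed
  have nz: "triple p x f \<noteq> 0 \<or> triple p e x \<noteq> 0" if "triple p x z \<noteq> 0" for x z
    using that T triple_plucker[of p e f x z] by auto
  have coord: "has_coordinate scale_fun (triple p e) (triple p f)
      (dual_point (line_through (vec.span {p}) (vec.span {x}))) (ratio (triple p x f) (triple p e x))"
    if "triple p x z \<noteq> 0" for x z
    unfolding has_coordinate_def
  proof (intro exI conjI)
    show "triple p x f \<noteq> 0 \<or> triple p e x \<noteq> 0" by (rule nz[OF that])
    show "dual_point (line_through (vec.span {p}) (vec.span {x})) =
        func.span {scale_fun (triple p x f) (triple p e) + scale_fun (triple p e x) (triple p f)}"
      unfolding exp func.span_singleton_scale[OF T] by (rule dual_point_line_through[OF that])
  qed simp
  have swap: "triple p y x \<noteq> 0" if "triple p x y \<noteq> 0" for x y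
    using that by (simp add: triple_swap(2)[of p x y])
  have distinct: "dual_point (line_through (vec.span {p}) (vec.span {x})) \<noteq>
      dual_point (line_through (vec.span {p}) (vec.span {y}))" if "triple p x y \<noteq> 0" for x y
  proof -
    have False if "func.span {triple p x} = func.span {triple p y}"
    proof -
      have "triple p x \<in> func.span {triple p y}"
        using that func.span_base[of "triple p x" "{triple p x}"] by simp
      then show False
        using \<open>triple p x y \<noteq> 0\<close> by (auto simp: func.span_singleton scale_fun_def)
    qed
    then show ?thesis
      unfolding dual_point_line_through[OF that] dual_point_line_through[OF swap[OF that]] by blast
  qed
  have "\<exists>z. triple p a z \<noteq> 0" "\<exists>z. triple p b z \<noteq> 0" "\<exists>z. triple p c z \<noteq> 0" "\<exists>z. triple p d z \<noteq> 0"
    using assms swap by blast+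
  then obtain za zb zc zd where z: "triple p a za \<noteq> 0" "triple p b zb \<noteq> 0"
      "triple p c zc \<noteq> 0" "triple p d zd \<noteq> 0" by blast
  have "line_cross_ratio (line_through (vec.span {p}) (vec.span {a}))
      (line_through (vec.span {p}) (vec.span {b})) (line_through (vec.span {p}) (vec.span {c}))
      (line_through (vec.span {p}) (vec.span {d})) =
    cross_ratio (ratio (triple p a f) (triple p e a)) (ratio (triple p b f) (triple p e b))
      (ratio (triple p c f) (triple p e c)) (ratio (triple p d f) (triple p e d))"
    unfolding line_cross_ratio_def
    by (rule func.projective_cross_ratio_eqI[OF ind coord[OF z(1)] coord[OF z(2)]
          coord[OF z(3)] coord[OF z(4)]]) (use distinct assms in blast)
  also have "\<dots> = ratio (triple p a c * triple p b d) (triple p b c * triple p a d)"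
    unfolding cross_ratio_ratio[OF nz[OF z(1)] nz[OF z(2)] nz[OF z(3)] nz[OF z(4)]]
  proof (rule ratio_eqI)
    show "triple p e f * triple p e f \<noteq> 0" using T by simp
    have *: "triple p x f * triple p e y - triple p e x * triple p y f = triple p e f * triple p x y"
      for x y by (rule triple_plucker[symmetric])
    show "(triple p a f * triple p e c - triple p e a * triple p c f) *
        (triple p b f * triple p e d - triple p e b * triple p d f) =
      triple p e f * triple p e f * (triple p a c * triple p b d)"
      "(triple p b f * triple p e c - triple p e b * triple p c f) *
        (triple p a f * triple p e d - triple p e a * triple p d f) =
      triple p e f * triple p e f * (triple p b c * triple p a d)"
      unfolding * by simp_all
  qed
  finally show ?thesis .
qed

section \<open>The pencil of conics through a quadrangle\<close>

text \<open>The degenerate conic made of the line ab and the line cd.\<close>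

definition line_pair :: "complex ^ 3 \<Rightarrow> complex ^ 3 \<Rightarrow> complex ^ 3 \<Rightarrow> complex ^ 3 \<Rightarrow> complex ^ 3 \<Rightarrow> complex" where
  "line_pair a b c d x = triple x a b * triple x c d"

lemma line_pair_quadratic: "line_pair a b c d \<in> quadratic_forms"
  unfolding quadratic_forms_def
proof (intro CollectI exI allI)
  have *: "triple x y z = (\<Sum>i\<in>UNIV. triple (axis i 1) y z * x $ i)" for x y z :: "complex ^ 3"
    by (simp add: sum_3 triple_def axis_def algebra_simps)
  fix x
  show "line_pair a b c d x = (\<Sum>i\<in>UNIV. \<Sum>j\<in>UNIV.
      (\<chi> i j. triple (axis i 1) a b * triple (axis j 1) c d) $ i $ j * x $ i * x $ j)"
    unfolding line_pair_def *[of x] sum_product by (simp add: mult_ac)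
qed

section \<open>The line pairs \<open>q\<^sub>0\<close> and \<open>q\<^sub>1\<close> as a basis of
  the pencil\<close>

locale quadrangle =
  fixes a b c d :: "complex ^ 3"
  assumes abc: "triple a b c \<noteq> 0" and abd: "triple a b d \<noteq> 0"
    and acd: "triple a c d \<noteq> 0" and bcd: "triple b c d \<noteq> 0"
begin

abbreviation "q\<^sub>0 \<equiv> line_pair a c b d"
abbreviation "q\<^sub>1 \<equiv> line_pair b c a d"

text \<open>A common zero lies on one line of each pair, and these meet in a base point: ac and bc
  in c, ac and ad in a, bd and bc in b, bd and ad in d. In each case Cramer's expansion shrinks to a
  single term.\<close>

lemma base_point_if_zero:
  assumes "q\<^sub>0 p = 0" "q\<^sub>1 p = 0" "p \<noteq> 0"
  shows "vec.span {p} \<in> {vec.span {a}, vec.span {b}, vec.span {c}, vec.span {d}}"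
proof -
  have *: "vec.span {p} = vec.span {x}" if "s *s p = t *s x" "s \<noteq> 0" for s t x
  proof -
    have "t \<noteq> 0" using that assms(3) by auto
    then show ?thesis using that by (metis vec.span_singleton_scale)
  qed
  from assms(1,2) consider "triple p a c = 0" "triple p b c = 0" | "triple p a c = 0" "triple p a d = 0"
    | "triple p b d = 0" "triple p b c = 0" | "triple p b d = 0" "triple p a d = 0"
    by (auto simp: line_pair_def)
  then show ?thesis
  proof cases
    case 1
    then have "triple a b c *s p = triple a b p *s c"
      using triple_cramer[of a b c p] by (simp add: triple_swap(1)[of p a])
    from *[OF this abc] show ?thesis by simp
  next
    case 2
    then have "triple a c d *s p = triple p c d *s a"
      using triple_cramer[of a c d p] by (simp add: triple_swap(1)[of p a] triple_swap(2)[of a p c])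
    from *[OF this acd] show ?thesis by simp
  next
    case 3
    then have "triple b c d *s p = triple p c d *s b"
      using triple_cramer[of b c d p] by (simp add: triple_swap(1)[of p b] triple_swap(2)[of b p c])
    from *[OF this bcd] show ?thesis by simp
  next
    case 4
    then have "triple a b d *s p = triple a b p *s d"
      using triple_cramer[of a b d p] by (simp add: triple_swap(1)[of p a])
    from *[OF this abd] show ?thesis by simp
  qed
qed

lemma line_pair_zero_at_base:
  assumes "x \<in> {a, b, c, d}" "p \<in> vec.span {x}"
  shows "q\<^sub>0 p = 0" "q\<^sub>1 p = 0"
  using assms by (auto simp: line_pair_def vec.span_singleton triple_scale)

lemma exists_q\<^sub>0_nonzero: "\<exists>p. q\<^sub>0 p \<noteq> 0 \<and> q\<^sub>1 p = 0"
  using abc bcd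
  \<comment> \<open>This point is on the line bc but on neither ac nor bd.\<close>
  by (intro exI[of _ "b + c"])
    (simp add: line_pair_def triple_add triple_swap(1)[of a b] triple_swap(1)[of b c])

lemma exists_q\<^sub>1_nonzero: "\<exists>p. q\<^sub>0 p = 0 \<and> q\<^sub>1 p \<noteq> 0"
  using abc acd
  by (intro exI[of _ "a + c"])
    (simp add: line_pair_def triple_add triple_swap(1)[of a c])

text \<open>Needed for the existence half of the definite description in
  \<open>conic_cross_ratio\<close>. In the coordinates x, y chosen below, c is the origin, d is (1,
  1), and a, b are the points at infinity of the two axes.\<close>

lemma exists_further_point:
  assumes "l \<noteq> 0 \<or> m \<noteq> 0"
  shows "\<exists>p. l * q\<^sub>0 p + m * q\<^sub>1 p = 0 \<and> (q\<^sub>0 p \<noteq> 0 \<or> q\<^sub>1 p \<noteq> 0)"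
proof -
  define K where "K = triple a b c * triple a b d * triple a c d * triple b c d"
  have K: "K \<noteq> 0" using abc abd acd bcd by (simp add: K_def)
  \<comment> \<open>With these coordinates, the equation of the conic becomes \<open>l y (x - 1) + m x (y - 1) = 0\<close>.\<close>
  define p where "p x y = (x * triple b c d) *s a - (y * triple a c d) *s b + triple a b d *s c" for x y
  have minus: "triple (x - x') y z = triple x y z - triple x' y z" for x x' y z :: "complex ^ 3"
    by (simp add: triple_def algebra_simps)
  have swaps: "triple b a c = - triple a b c" "triple c b d = - triple b c d"
    "triple b a d = - triple a b d" "triple c a d = - triple a c d"
    by (rule triple_swap)+
  have p: "q\<^sub>0 (p x y) = K * (y * (x - 1))" "q\<^sub>1 (p x y) = K * (x * (y - 1))" for x y
    by (simp_all add: line_pair_def p_def minus triple_add triple_scale swaps K_def)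
      (simp_all add: algebra_simps)
  have *: ?thesis if "l * (y * (x - 1)) + m * (x * (y - 1)) = 0" "y * (x - 1) \<noteq> 0 \<or> x * (y - 1) \<noteq> 0" for x y
  proof (intro exI conjI)
    have "l * q\<^sub>0 (p x y) + m * q\<^sub>1 (p x y) = K * (l * (y * (x - 1)) + m * (x * (y - 1)))"
      by (simp add: p algebra_simps)
    with that(1) show "l * q\<^sub>0 (p x y) + m * q\<^sub>1 (p x y) = 0" by simp
    show "q\<^sub>0 (p x y) \<noteq> 0 \<or> q\<^sub>1 (p x y) \<noteq> 0" using that(2) K by (simp add: p)
  qed
  \<comment> \<open>For m = 0 the intersection of ac and bd serves. Otherwise the conic is cut with
    x = 2, where y solves a linear equation with leading coefficient l + 2 m; if that is zero, the
    line x = 3 is used. The instantiations of \<open>*\<close> list y before x.\<close>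
  consider "m = 0" | "m \<noteq> 0" "l + 2 * m \<noteq> 0" | "l = - 2 * m"
    by (metis add_eq_0_iff2 mult_minus_left)
  then show ?thesis
  proof cases
    case 1
    then show ?thesis by (intro *[of 0 1]) auto
  next
    case 2
    then show ?thesis by (intro *[of "2 * m / (l + 2 * m)" 2]) (auto simp: field_simps)
  next
    case 3
    then show ?thesis by (intro *[of "- 3" 3]) (auto simp: algebra_simps)
  qed
qed

text \<open>Seen from a further point p, the cross ratio is q0 p : q1 p, which the equation of the
  conic forces to be - m : l, whatever p is. A point of the conic outside the base is never a common
  zero, so this covers all admissible P.\<close>

lemma conic_cross_ratio_member:
  assumes lm: "l \<noteq> 0 \<or> m \<noteq> 0"
  shows "conic_cross_ratio (func.span {scale_fun l q\<^sub>0 + scale_fun m q\<^sub>1})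
      (vec.span {a}) (vec.span {b}) (vec.span {c}) (vec.span {d}) = ratio (- m) l"
proof -
  let ?\<Gamma> = "func.span {scale_fun l q\<^sub>0 + scale_fun m q\<^sub>1}"
  let ?base = "{vec.span {a}, vec.span {b}, vec.span {c}, vec.span {d}}"
  let ?cr = "\<lambda>P. line_cross_ratio (line_through P (vec.span {a})) (line_through P (vec.span {b}))
      (line_through P (vec.span {c})) (line_through P (vec.span {d}))"
  have cr_eq: "?cr (vec.span {p}) = ratio (- m) l"
    if 0: "l * q\<^sub>0 p + m * q\<^sub>1 p = 0" and ne: "q\<^sub>0 p \<noteq> 0 \<or> q\<^sub>1 p \<noteq> 0" for p
  proof -
    have "?cr (vec.span {p}) = ratio (q\<^sub>0 p) (q\<^sub>1 p)"
      unfolding line_pair_def using ne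
      by (intro line_cross_ratio_line_through) (auto simp: line_pair_def)
    also have "\<dots> = ratio (- m) l"
    proof (cases "l = 0")
      \<comment> \<open>Here the conic is q1 = 0, and both sides are infinity.\<close>
      case True
      with lm 0 ne show ?thesis by (auto simp: ratio_def)
    next
      case False
      then have "q\<^sub>0 p = q\<^sub>1 p / l * (- m)" "q\<^sub>1 p = q\<^sub>1 p / l * l"
        using 0 by (simp_all add: field_simps eq_neg_iff_add_eq_0)
      moreover have "q\<^sub>1 p / l \<noteq> 0"
        using False 0 ne by auto
      ultimately show ?thesis by (intro ratio_eqI)
    qed
    finally show ?thesis .
  qed
  have on_conic: "vec.span {p} \<in> conic_points ?\<Gamma> \<longleftrightarrow> l * q\<^sub>0 p + m * q\<^sub>1 p = 0" if "p \<noteq> 0" for p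
  proof
    assume "vec.span {p} \<in> conic_points ?\<Gamma>"
    then have "(scale_fun l q\<^sub>0 + scale_fun m q\<^sub>1) p = 0"
      using vec.span_base[of p "{p}"] func.span_base[of "scale_fun l q\<^sub>0 + scale_fun m q\<^sub>1"]
      unfolding conic_points_def by blast
    then show "l * q\<^sub>0 p + m * q\<^sub>1 p = 0" by (simp add: scale_fun_def)
  next
    assume 0: "l * q\<^sub>0 p + m * q\<^sub>1 p = 0"
    \<comment> \<open>Homogeneity of degree two: vanishing does not depend on the representatives of
      the conic and of the point.\<close>
    have "scale_fun k (scale_fun l q\<^sub>0 + scale_fun m q\<^sub>1) (t *s p) =
        k * t * t * (l * q\<^sub>0 p + m * q\<^sub>1 p)" for k t
      by (simp add: scale_fun_def line_pair_def triple_scale algebra_simps)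
    then show "vec.span {p} \<in> conic_points ?\<Gamma>"
      using 0 that
      by (auto simp: conic_points_def CP2_def projective_points_def vec.span_singleton func.span_singleton)
  qed
  show ?thesis
    unfolding conic_cross_ratio_def
  proof (rule the_equality)
    obtain p where p: "l * q\<^sub>0 p + m * q\<^sub>1 p = 0" "q\<^sub>0 p \<noteq> 0 \<or> q\<^sub>1 p \<noteq> 0"
      using exists_further_point[OF lm] by blast
    then have "p \<noteq> 0" by (auto simp: line_pair_def)
    moreover have "vec.span {p} \<notin> ?base"
      using p(2) line_pair_zero_at_base[of _ p] vec.span_base[of p "{p}"] by auto
    ultimately show "\<exists>P. P \<in> conic_points ?\<Gamma> \<and> P \<notin> ?base \<and> ratio (- m) l = ?cr P"
      using on_conic cr_eq p by (intro exI[of _ "vec.span {p}"]) simp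
  next
    fix k assume "\<exists>P. P \<in> conic_points ?\<Gamma> \<and> P \<notin> ?base \<and> k = ?cr P"
    then obtain P where P: "P \<in> conic_points ?\<Gamma>" "P \<notin> ?base" "k = ?cr P" by blast
    then obtain p where p: "p \<noteq> 0" "P = vec.span {p}"
      by (auto simp: conic_points_def CP2_def projective_points_def)
    then show "k = ratio (- m) l"
      using P on_conic cr_eq base_point_if_zero[of p] by blast
  qed
qed

lemma line_pair_in_pencil:
  assumes "q \<in> {q\<^sub>0, q\<^sub>1}"
  shows "func.span {q} \<in> conics"
    "{vec.span {a}, vec.span {b}, vec.span {c}, vec.span {d}} \<subseteq> conic_points (func.span {q})"
proof -
  have "q \<noteq> 0" "q \<in> quadratic_forms"
    using assms exists_q\<^sub>0_nonzero exists_q\<^sub>1_nonzero line_pair_quadratic by auto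
  then show "func.span {q} \<in> conics"
    by (auto simp: conics_def projective_points_def)
  have nz: "a \<noteq> 0" "b \<noteq> 0" "c \<noteq> 0" "d \<noteq> 0" using abc abd by auto
  have "vec.span {x} \<in> conic_points (func.span {q})" if "x \<in> {a, b, c, d}" for x
    using that assms nz line_pair_zero_at_base[OF that]
    by (auto simp: conic_points_def CP2_def projective_points_def func.span_singleton scale_fun_def)
  then show "{vec.span {a}, vec.span {b}, vec.span {c}, vec.span {d}} \<subseteq> conic_points (func.span {q})"
    by simp
qed

text \<open>As a projective line, F comes with some unknown basis u, v. It contains the two distinct
  points given by the line pairs, so these span the same plane as u and v.\<close>

lemma pencil_member:
  assumes "F \<in> pencils" "func.span {q\<^sub>0} \<in> F" "func.span {q\<^sub>1} \<in> F" "\<Gamma> \<in> F"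
  obtains l m where "l \<noteq> 0 \<or> m \<noteq> 0" "\<Gamma> = func.span {scale_fun l q\<^sub>0 + scale_fun m q\<^sub>1}"
proof -
  obtain u v where F: "F = {p \<in> projective_points scale_fun quadratic_forms. p \<subseteq> func.span {u, v}}"
    using assms(1) by (auto simp: pencils_def projective_lines_def)
  have "q\<^sub>0 \<in> func.span {u, v}" "q\<^sub>1 \<in> func.span {u, v}"
    using assms(2,3) func.span_base[of q\<^sub>0 "{q\<^sub>0}"] func.span_base[of q\<^sub>1 "{q\<^sub>1}"] by (auto simp: F)
  then obtain r s r' s' where q: "q\<^sub>0 = scale_fun r u + scale_fun s v" "q\<^sub>1 = scale_fun r' u + scale_fun s' v"
    by (auto simp: func.mem_span_pair_iff)
  have ne: "q\<^sub>0 \<noteq> 0" "q\<^sub>1 \<noteq> 0"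
    using exists_q\<^sub>0_nonzero exists_q\<^sub>1_nonzero by auto
  have "func.span {q\<^sub>0} \<noteq> func.span {q\<^sub>1}"
  proof
    assume "func.span {q\<^sub>0} = func.span {q\<^sub>1}"
    then obtain t where "t \<noteq> 0" "q\<^sub>1 = scale_fun t q\<^sub>0"
      using func.span_singleton_eqD ne by blast
    with exists_q\<^sub>1_nonzero show False by (auto simp: scale_fun_def)
  qed
  moreover have "r \<noteq> 0 \<or> s \<noteq> 0" "r' \<noteq> 0 \<or> s' \<noteq> 0"
    using ne q by auto
  ultimately have "r * s' - s * r' \<noteq> 0"
    using func.has_coordinate_distinctD q by metis
  moreover have "q\<^sub>0 \<in> func.span {q\<^sub>0, q\<^sub>1}" "q\<^sub>1 \<in> func.span {q\<^sub>0, q\<^sub>1}"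
    by (simp_all add: func.span_base)
  ultimately have "u \<in> func.span {q\<^sub>0, q\<^sub>1} \<and> v \<in> func.span {q\<^sub>0, q\<^sub>1}"
    by (intro func.mem_subspace_pair[of _ r _ s _ r' s']) (simp_all flip: q)
  then have sub: "func.span {u, v} \<subseteq> func.span {q\<^sub>0, q\<^sub>1}"
    by (simp add: func.span_minimal)
  obtain w where w: "w \<noteq> 0" "\<Gamma> = func.span {w}" "\<Gamma> \<subseteq> func.span {u, v}"
    using assms(4) by (auto simp: F projective_points_def)
  then have "w \<in> func.span {q\<^sub>0, q\<^sub>1}"
    using sub func.span_base[of w "{w}"] by auto
  then obtain l m where lm: "w = scale_fun l q\<^sub>0 + scale_fun m q\<^sub>1"
    by (auto simp: func.mem_span_pair_iff)
  with w show ?thesis by (intro that[of l m]) auto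
qed

end

section \<open>Comparison of the two cross ratios\<close>

theorem theorem4:
  fixes F :: "conic set" and A B C D :: point and \<Gamma>1 \<Gamma>2 \<Gamma>3 \<Gamma>4 :: conic
    and k1 k2 k3 k4 :: "complex option"
  assumes "nondegenerate_pencil F A B C D"
    and "{\<Gamma>1, \<Gamma>2, \<Gamma>3, \<Gamma>4} \<subseteq> F"
    and "distinct [\<Gamma>1, \<Gamma>2, \<Gamma>3, \<Gamma>4]"
    and "k1 = conic_cross_ratio \<Gamma>1 A B C D"
    and "k2 = conic_cross_ratio \<Gamma>2 A B C D"
    and "k3 = conic_cross_ratio \<Gamma>3 A B C D"
    and "k4 = conic_cross_ratio \<Gamma>4 A B C D"
  shows "conics_cross_ratio \<Gamma>1 \<Gamma>2 \<Gamma>3 \<Gamma>4 = cross_ratio k1 k2 k3 k4"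
proof -
  have F: "F \<in> pencils" "F = {\<Gamma> \<in> conics. {A, B, C, D} \<subseteq> conic_points \<Gamma>}"
    and "{A, B, C, D} \<subseteq> CP2" "distinct [A, B, C, D]"
    and ncol: "\<not> collinear_points A B C" "\<not> collinear_points A B D"
      "\<not> collinear_points A C D" "\<not> collinear_points B C D"
    using assms(1) unfolding nondegenerate_pencil_def by blast+
  have rep: "\<exists>x. x \<noteq> 0 \<and> P = vec.span {x}" if "P \<in> CP2" for P
    using that unfolding CP2_def projective_points_def by blast
  obtain a b c d where nz: "a \<noteq> 0" "b \<noteq> 0" "c \<noteq> 0" "d \<noteq> 0"
    and abcd: "A = vec.span {a}" "B = vec.span {b}" "C = vec.span {c}" "D = vec.span {d}"
    using rep[of A] rep[of B] rep[of C] rep[of D] \<open>{A, B, C, D} \<subseteq> CP2\<close> by auto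
  have dist: "vec.span {a} \<noteq> vec.span {b}" "vec.span {a} \<noteq> vec.span {c}" "vec.span {b} \<noteq> vec.span {c}"
    using \<open>distinct [A, B, C, D]\<close> unfolding abcd by simp_all
  note ncol = ncol[unfolded abcd]
  interpret quadrangle a b c d
  proof
    show "triple a b c \<noteq> 0" by (rule triple_ne_0[OF nz(1,2,3) dist(1) ncol(1)])
    show "triple a b d \<noteq> 0" by (rule triple_ne_0[OF nz(1,2,4) dist(1) ncol(2)])
    show "triple a c d \<noteq> 0" by (rule triple_ne_0[OF nz(1,3,4) dist(2) ncol(3)])
    show "triple b c d \<noteq> 0" by (rule triple_ne_0[OF nz(2,3,4) dist(3) ncol(4)])
  qed
  have mem: "func.span {q\<^sub>0} \<in> F" "func.span {q\<^sub>1} \<in> F"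
    unfolding F(2) abcd using line_pair_in_pencil by blast+
  have "s = 0 \<and> t = 0" if "scale_fun s (- q\<^sub>1) + scale_fun t q\<^sub>0 = 0" for s t
  proof -
    have eq: "- (s * q\<^sub>1 p) + t * q\<^sub>0 p = 0" for p
      using fun_cong[OF that, of p] by (simp add: scale_fun_def)
    obtain p where "q\<^sub>0 p \<noteq> 0" "q\<^sub>1 p = 0" using exists_q\<^sub>0_nonzero by blast
    with eq[of p] have "t = 0" by simp
    obtain p where "q\<^sub>0 p = 0" "q\<^sub>1 p \<noteq> 0" using exists_q\<^sub>1_nonzero by blast
    with eq[of p] have "s = 0" by simp
    with \<open>t = 0\<close> show ?thesis by simp
  qed
  then have "- q\<^sub>1 \<noteq> q\<^sub>0 \<and> func.independent {- q\<^sub>1, q\<^sub>0}"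
    unfolding func.independent_pair_iff by blast
  then have ind: "- q\<^sub>1 \<noteq> q\<^sub>0" "func.independent {- q\<^sub>1, q\<^sub>0}"
    by simp_all
  have coord: "has_coordinate scale_fun (- q\<^sub>1) q\<^sub>0 \<Gamma> (conic_cross_ratio \<Gamma> A B C D)" if \<Gamma>: "\<Gamma> \<in> F" for \<Gamma>
  proof -
    obtain l m where lm: "l \<noteq> 0 \<or> m \<noteq> 0" "\<Gamma> = func.span {scale_fun l q\<^sub>0 + scale_fun m q\<^sub>1}"
      using pencil_member[OF F(1) mem \<Gamma>] .
    \<comment> \<open>The sign in the basis is chosen so that the coordinate is - m : l, the cross
      ratio of the base points on this conic.\<close>
    have "scale_fun (- m) (- q\<^sub>1) + scale_fun l q\<^sub>0 = scale_fun l q\<^sub>0 + scale_fun m q\<^sub>1"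
      by (simp add: scale_fun_def fun_eq_iff)
    then show ?thesis
      unfolding has_coordinate_def
    proof (intro exI conjI)
      show "- m \<noteq> 0 \<or> l \<noteq> 0" using lm(1) by auto
      show "conic_cross_ratio \<Gamma> A B C D = ratio (- m) l"
        unfolding abcd lm(2) by (rule conic_cross_ratio_member[OF lm(1)])
    qed (simp only: lm(2))
  qed
  have "\<Gamma>1 \<in> F" "\<Gamma>2 \<in> F" "\<Gamma>3 \<in> F" "\<Gamma>4 \<in> F"
    using assms(2) by simp_all
  note coords = this[THEN coord]
  show ?thesis
    unfolding conics_cross_ratio_def assms(4-7)
    by (rule func.projective_cross_ratio_eqI[OF ind coords]) (use assms(3) in simp)
qed

end
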